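(* Let $P \in \mathcal{H}_n$ and let $Q$ be a complex polynomial of degree at most $n-1$. For $\lambda \in \mathbb{R}$ set $R_\lambda(x) = P(x+\lambda) - \lambda Q(x+\lambda)$. If $R_\lambda \in \mathcal{H}_n$ and $R_0 \preccurlyeq R_\lambda$ for all small $\lambda \in \mathbb{R}$ (i.e. there is $\delta>0$ such that this holds for all real $\lambda$ with $|\lambda|<\delta$), then $Q = P'$.
   Context: $\mathcal{H}_n$ denotes the set of monic hyperbolic polynomials of degree $n$, i.e. monic polynomials of degree $n$ all of whose zeros are real. For a polynomial $P$ of degree $n$, $Z(P)$ is the unordered $n$-tuple of its zeros, each repeated according to multiplicity. For two unordered $n$-tuples $X=(x_1,\dots,x_n)$ and $Y=(y_1,\dots,y_n)$ of real numbers, $X \prec Y$ ($X$ is majorized by $Y$, or less than $Y$ in the spectral order) means that $\sum_{i=1}^n f(x_i) \le \sum_{i=1}^n f(y_i)$ for every convex function $f:\mathbb{R}\to\mathbb{R}$; equivalently, there is a doubly stochastic $n\times n$ matrix $A$ with $(x_1,\dots,x_n)^t = A (y_1,\dots,y_n)^t$. For $P,Q\in\mathcal{H}_n$, $P \preccurlyeq Q$ means $Z(P) \prec Z(Q)$. *)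

theory Defs
  imports "HOL-Analysis.Analysis" "HOL-Computational_Algebra.Computational_Algebra"
begin

definition monic_hyperbolic :: "nat \<Rightarrow> complex poly set" where
  "monic_hyperbolic n =
     {P. lead_coeff P = 1 \<and> degree P = n \<and> (\<forall>z. poly P z = 0 \<longrightarrow> z \<in> \<real>)}"

text \<open>An unordered tuple of reals is a multiset of reals. On polynomials all of whose zeros
  are real, \<^term>\<open>Re\<close> is just the passage from the real complex numbers to the reals.\<close>

definition zero_tuple :: "complex poly \<Rightarrow> real multiset" where
  "zero_tuple P = image_mset Re (proots P)"

definition majorized :: "real multiset \<Rightarrow> real multiset \<Rightarrow> bool" (infix "\<prec>" 50) where
  "X \<prec> Y \<longleftrightarrow> size X = size Y \<and>
     (\<forall>f :: real \<Rightarrow> real. convex_on UNIV f \<longrightarrow> (\<Sum>x\<in>#X. f x) \<le> (\<Sum>y\<in>#Y. f y))"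

definition spectral_le :: "complex poly \<Rightarrow> complex poly \<Rightarrow> bool" (infix "\<preceq>\<^sub>s" 50) where
  "P \<preceq>\<^sub>s Q \<longleftrightarrow> zero_tuple P \<prec> zero_tuple Q"

definition shifted_pencil :: "complex poly \<Rightarrow> complex poly \<Rightarrow> real \<Rightarrow> complex poly" where
  "shifted_pencil P Q t =
     pcompose P [:of_real t, 1:] - smult (of_real t) (pcompose Q [:of_real t, 1:])"

end

theory Submission
  imports Defs
begin

text \<open>
  Let \<open>R\<^sub>t(x) = P(x + t) - t Q(x + t)\<close>. Testing the majorization \<open>Z(R\<^sub>0) \<prec> Z(R\<^sub>t)\<close> on the single
  family of functions \<open>y \<mapsto> - ln (b - y)\<close> suffices, where \<open>b\<close> is a real number to the right of
  all zeros involved. Since \<open>R\<^sub>t\<close> is monic, the sum of this function over \<open>Z(R\<^sub>t)\<close> is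
  \<open>- ln R\<^sub>t(b)\<close>, so the hypothesis says that the real function \<open>t \<mapsto> R\<^sub>t(b)\<close> has a local maximum
  at \<open>t = 0\<close>. Both signs of \<open>t\<close> are admitted, hence its derivative \<open>P'(b) - Q(b)\<close> vanishes there.
  This holds for every large \<open>b\<close>, and two polynomials that agree at infinitely many points are
  equal.

  Two points need care. The function \<open>- ln (b - y)\<close> is convex only on the half-line \<open>y < b\<close>; it is
  continued by its tangent line from \<open>y = b - 1\<close> on (\<open>log_barrier\<close>). And a single \<open>b\<close> must lie to
  the right of the zeros of \<open>R\<^sub>t\<close> for all small \<open>t\<close>; this holds because \<open>P\<close> dominates \<open>Q\<close> near
  infinity (\<open>shifted_pencil_roots_bounded\<close>).
\<close>

section \<open>A convex function whose sum over the zeros is a logarithm\<close>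

definition log_barrier :: "real \<Rightarrow> real \<Rightarrow> real" where
  "log_barrier b y = (if y \<le> b - 1 then - ln (b - y) else y - b + 1)"

text \<open>
  The lines on the left are the tangents of \<open>w \<mapsto> - ln w\<close> at the points \<open>s \<ge> 1\<close>, with \<open>w = b - y\<close>.
  The barrier is their upper envelope, which is the reason for its convexity.
\<close>

lemma tangent_le_log_barrier:
  assumes "s \<ge> 1"
  shows "1 - (b - y) / s - ln s \<le> log_barrier b y"
proof (cases "y \<le> b - 1")
  case True
  then have w: "b - y > 0" by simp
  have "ln ((b - y) / s) \<le> (b - y) / s - 1"
    using w assms by (intro ln_le_minus_one) simp
  then show ?thesis
    using True w assms by (simp add: log_barrier_def ln_div)
next
  case False
  have "ln (1 / s) \<le> 1 / s - 1"
    using assms by (intro ln_le_minus_one) simp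
  then have ln_s: "1 - 1 / s \<le> ln s"
    using assms by (simp add: ln_div)
  have "(b - y) * (1 - 1 / s) \<le> 1 * (1 - 1 / s)"
    using False assms by (intro mult_right_mono) (auto simp: field_simps)
  with ln_s have "(b - y) * (1 - 1 / s) \<le> ln s" by simp
  then show ?thesis
    using False by (simp add: log_barrier_def algebra_simps)
qed

lemma log_barrier_eq_tangent:
  "log_barrier b y = 1 - (b - y) / max (b - y) 1 - ln (max (b - y) 1)"
proof (cases "y \<le> b - 1")
  case True
  then have "max (b - y) 1 = b - y" "b - y \<noteq> 0" by auto
  with True show ?thesis by (simp add: log_barrier_def)
next
  case False
  then have "max (b - y) 1 = 1" by simp
  with False show ?thesis by (simp add: log_barrier_def)
qed

lemma convex_log_barrier: "convex_on UNIV (log_barrier b)"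
proof (rule convex_onI)
  fix t x y :: real
  assume t: "t > 0" "t < 1"
  define m where "m = (1 - t) *\<^sub>R x + t *\<^sub>R y"
  define s where "s = max (b - m) 1"
  have s: "s \<ge> 1" by (simp add: s_def)
  have "log_barrier b m = 1 - (b - m) / s - ln s"
    by (simp add: log_barrier_eq_tangent s_def)
  also have "\<dots> = (1 - t) * (1 - (b - x) / s - ln s) + t * (1 - (b - y) / s - ln s)"
    using s by (simp add: m_def field_simps)
  also have "\<dots> \<le> (1 - t) * log_barrier b x + t * log_barrier b y"
    using t s by (intro add_mono mult_left_mono tangent_le_log_barrier) auto
  finally show "log_barrier b ((1 - t) *\<^sub>R x + t *\<^sub>R y)
      \<le> (1 - t) * log_barrier b x + t * log_barrier b y"
    by (simp add: m_def)
qed simp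

lemma prod_mset_linear_factors_eq_exp:
  fixes M :: "complex multiset"
  assumes "\<And>z. z \<in># M \<Longrightarrow> z \<in> \<real> \<and> Re z \<le> b - 1"
  shows "(\<Prod>z\<in>#M. of_real b - z) = of_real (exp (- (\<Sum>z\<in>#M. log_barrier b (Re z))))"
  using assms
proof (induction M)
  case empty
  then show ?case by simp
next
  case (add z M)
  have z: "z = of_real (Re z)" "Re z \<le> b - 1"
    using add.prems[of z] by (auto simp: complex_is_Real_iff complex_eq_iff)
  have "exp (- log_barrier b (Re z)) = b - Re z"
    using z(2) by (simp add: log_barrier_def)
  then have "of_real b - z = of_real (exp (- log_barrier b (Re z)))"
    using z(1) by (metis of_real_diff)
  then show ?case
    using add by (simp add: exp_add[symmetric] flip: of_real_mult)
qed

text \<open>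
  The exponential form records at once that the value is real, that it is positive, and that it
  decreases when the sum of the barrier over the zeros increases.
\<close>

lemma poly_monic_hyperbolic_eq_exp:
  assumes R: "R \<in> monic_hyperbolic n"
    and right: "\<And>z. poly R z = 0 \<Longrightarrow> Re z \<le> b - 1"
  shows "poly R (of_real b) = of_real (exp (- (\<Sum>y\<in>#zero_tuple R. log_barrier b y)))"
proof -
  have lc: "lead_coeff R = 1" and real: "\<And>z. poly R z = 0 \<Longrightarrow> z \<in> \<real>"
    using R by (auto simp: monic_hyperbolic_def)
  then have "R \<noteq> 0" by auto
  have "poly R (of_real b) = poly (\<Prod>z\<in>#proots R. [:- z, 1:]) (of_real b)"
    using complex_poly_decompose_multiset[of R] lc by simp
  also have "\<dots> = (\<Prod>z\<in>#proots R. of_real b - z)"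
    by (simp add: poly_prod_mset)
  also have "\<dots> = of_real (exp (- (\<Sum>z\<in>#proots R. log_barrier b (Re z))))"
    using \<open>R \<noteq> 0\<close> real right by (intro prod_mset_linear_factors_eq_exp) auto
  finally show ?thesis
    by (simp add: zero_tuple_def image_mset.compositionality o_def)
qed

section \<open>The shifted pencil\<close>

lemma poly_shifted_pencil:
  "poly (shifted_pencil P Q t) z = poly P (z + of_real t) - of_real t * poly Q (z + of_real t)"
  by (simp add: shifted_pencil_def poly_pcompose add.commute)

lemma poly_dominates_lower_degree:
  fixes P Q :: "complex poly"
  assumes "degree Q < degree P"
  obtains B where "\<And>z. norm z \<ge> B \<Longrightarrow> norm (poly Q z) < norm (poly P z)"
proof -
  have "((\<lambda>z. poly Q z / poly P z) \<longlongrightarrow> 0) at_infinity"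
    using assms by (rule poly_divide_tendsto_0_at_infinity)
  then have "eventually (\<lambda>z. norm (poly Q z / poly P z) < 1) at_infinity"
    by (auto dest: tendstoD[where e = 1] simp: dist_norm)
  moreover have "eventually (\<lambda>z. poly P z \<noteq> 0) at_infinity"
    using assms by (intro filterlim_at_infinity_imp_eventually_ne filterlim_poly_at_infinity) simp
  ultimately have "eventually (\<lambda>z. norm (poly Q z) < norm (poly P z)) at_infinity"
    by eventually_elim (simp add: norm_divide divide_simps)
  then show thesis
    using that by (auto simp: eventually_at_infinity)
qed

text \<open>
  If \<open>z\<close> is a zero of \<open>R\<^sub>t\<close>, then \<open>P = t Q\<close> at \<open>z + t\<close>, which for \<open>\<bar>t\<bar> \<le> 1\<close> can happen only
  where \<open>P\<close> does not dominate \<open>Q\<close>. The bound is therefore uniform in \<open>t\<close>.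
\<close>

lemma shifted_pencil_roots_bounded:
  assumes dom: "\<And>z. norm z \<ge> B \<Longrightarrow> norm (poly Q z) < norm (poly P z)"
    and t: "\<bar>t\<bar> \<le> 1"
    and root: "poly (shifted_pencil P Q t) z = 0"
  shows "Re z \<le> B + 1"
proof -
  define w where "w = z + of_real t"
  have "norm (poly P w) = \<bar>t\<bar> * norm (poly Q w)"
    using root by (simp add: poly_shifted_pencil w_def norm_mult)
  also have "\<dots> \<le> norm (poly Q w)"
    using t by (intro mult_left_le_one_le) auto
  finally have "norm w < B"
    using dom[of w] by force
  moreover have "Re z = Re w - t"
    by (simp add: w_def)
  moreover have "Re w \<le> norm w"
    by (rule complex_Re_le_cmod)
  ultimately show ?thesis
    using t by linarith
qed

lemma has_field_derivative_shifted_pencil: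
  "((\<lambda>s. poly P (z + s) - s * poly Q (z + s)) has_field_derivative poly (pderiv P) z - poly Q z)
     (at (0 :: complex))"
  by (auto intro!: derivative_eq_intros)

text \<open>
  The coefficients of \<open>Q\<close> are complex, and so is the derivative of the pencil. Its real part
  vanishes at the local maximum, its imaginary part because the pencil is real for real \<open>t\<close>.
\<close>

lemma derivative_eq_0_if_real_local_max:
  fixes g :: "complex \<Rightarrow> complex"
  assumes deriv: "(g has_field_derivative D) (at 0)"
    and "\<delta> > 0"
    and real: "\<And>t::real. \<bar>t\<bar> < \<delta> \<Longrightarrow> g (of_real t) \<in> \<real>"
    and max: "\<And>t::real. \<bar>t\<bar> < \<delta> \<Longrightarrow> Re (g (of_real t)) \<le> Re (g 0)"
  shows "D = 0"
proof -
  have vec: "((\<lambda>t::real. g (of_real t)) has_vector_derivative D) (at 0)"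
    using deriv by (intro has_vector_derivative_real_field) simp
  have dRe: "((\<lambda>t. Re (g (of_real t))) has_real_derivative Re D) (at 0)"
    using vec has_vector_derivative_def has_field_derivative_Re by blast
  have dIm: "((\<lambda>t. Im (g (of_real t))) has_real_derivative Im D) (at 0)"
    using vec has_field_derivative_Im by blast
  have "Re D = 0"
    using DERIV_local_max[OF dRe \<open>\<delta> > 0\<close>] max by simp
  moreover have "Im D = 0"
    using DERIV_local_const[OF dIm \<open>\<delta> > 0\<close>] real[of 0] real \<open>\<delta> > 0\<close>
    by (simp add: complex_is_Real_iff)
  ultimately show ?thesis
    by (simp add: complex_eq_iff)
qed

section \<open>Identification of the perturbation\<close>

theorem theorem4:
  fixes n :: nat and P Q :: "complex poly"
  assumes "P \<in> monic_hyperbolic n"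
    and "Q = 0 \<or> degree Q < n"
    and "\<exists>\<delta>>0. \<forall>t::real. \<bar>t\<bar> < \<delta> \<longrightarrow>
           shifted_pencil P Q t \<in> monic_hyperbolic n \<and>
           shifted_pencil P Q 0 \<preceq>\<^sub>s shifted_pencil P Q t"
  shows "Q = pderiv P"
proof (cases "n = 0")
  case True
  then show ?thesis
    using assms(1,2) by (auto simp: monic_hyperbolic_def pderiv_eq_0_iff)
next
  case False
  have "degree P = n"
    using assms(1) by (simp add: monic_hyperbolic_def)
  then have "degree Q < degree P"
    using assms(2) False by auto
  then obtain B where dom: "\<And>z. norm z \<ge> B \<Longrightarrow> norm (poly Q z) < norm (poly P z)"
    by (rule poly_dominates_lower_degree) blast
  obtain \<delta>\<^sub>0 where "\<delta>\<^sub>0 > 0"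
    and hyp: "\<And>t. \<bar>t\<bar> < \<delta>\<^sub>0 \<Longrightarrow> shifted_pencil P Q t \<in> monic_hyperbolic n"
      "\<And>t. \<bar>t\<bar> < \<delta>\<^sub>0 \<Longrightarrow> zero_tuple (shifted_pencil P Q 0) \<prec> zero_tuple (shifted_pencil P Q t)"
    using assms(3) by (auto simp: spectral_le_def)
  define \<delta> where "\<delta> = min \<delta>\<^sub>0 1"
  have \<delta>: "\<delta> > 0" "\<delta> \<le> \<delta>\<^sub>0" "\<delta> \<le> 1"
    using \<open>\<delta>\<^sub>0 > 0\<close> by (auto simp: \<delta>_def)
  have agree: "poly (pderiv P) (of_real b) = poly Q (of_real b)" if b: "b \<ge> B + 2" for b :: real
  proof -
    define g where "g s = poly P (of_real b + s) - s * poly Q (of_real b + s)" for s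
    define S where "S t = (\<Sum>y\<in>#zero_tuple (shifted_pencil P Q t). log_barrier b y)" for t
    have g_exp: "g (of_real t) = of_real (exp (- S t))" if t: "\<bar>t\<bar> < \<delta>" for t
    proof -
      have "Re z \<le> b - 1" if "poly (shifted_pencil P Q t) z = 0" for z
      proof -
        have "Re z \<le> B + 1"
          using dom _ that by (rule shifted_pencil_roots_bounded) (use t \<delta> in auto)
        with b show ?thesis by simp
      qed
      then show ?thesis
        using poly_monic_hyperbolic_eq_exp[OF hyp(1), of t b] t \<delta>
        by (simp add: g_def S_def poly_shifted_pencil)
    qed
    have S_min: "S 0 \<le> S t" if "\<bar>t\<bar> < \<delta>" for t
      using hyp(2)[of t] that \<delta> convex_log_barrier by (auto simp: majorized_def S_def)
    have "(g has_field_derivative poly (pderiv P) (of_real b) - poly Q (of_real b)) (at 0)"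
      unfolding g_def by (rule has_field_derivative_shifted_pencil)
    then have "poly (pderiv P) (of_real b) - poly Q (of_real b) = 0"
      using \<delta>(1)
    proof (rule derivative_eq_0_if_real_local_max)
      show "g (of_real t) \<in> \<real>" if "\<bar>t\<bar> < \<delta>" for t
        using g_exp[OF that] by simp
      show "Re (g (of_real t)) \<le> Re (g 0)" if "\<bar>t\<bar> < \<delta>" for t
        using g_exp[OF that] g_exp[of 0] S_min[OF that] \<delta> by simp
    qed
    then show ?thesis by simp
  qed
  have "infinite ((of_real :: real \<Rightarrow> complex) ` {B + 2..})"
    by (simp add: finite_image_iff inj_on_def infinite_Ici)
  moreover have "of_real ` {B + 2..} \<subseteq> {z. poly (pderiv P - Q) z = 0}"
    using agree by auto
  ultimately have "infinite {z. poly (pderiv P - Q) z = 0}"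
    using finite_subset by blast
  then show ?thesis
    using poly_roots_finite[of "pderiv P - Q"] by auto
qed

end
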